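(* Let $N\ge4$ and $\kappa\in\mathbb R$ be such that the $(N-1)^2\times(N-1)^2$ matrix $\tilde A=M\otimes M^{-1}+M^{-1}\otimes M+2I\otimes I+\kappa(I\otimes M+M\otimes I)$ is nonsingular, and let $A=M\otimes S+S\otimes M+2I\otimes I+\kappa(I\otimes M+M\otimes I)$. Then the eigenspace $\{\boldsymbol v\in\mathbb R^{(N-1)^2}:\tilde A^{-1}A\boldsymbol v=\boldsymbol v\}$ of $\tilde A^{-1}A$ associated with the eigenvalue $1$ has dimension $(N-3)^2$.
   Context: $M,S$ are the $(N-1)\times(N-1)$ matrices $M_{mn}=(\psi_{n+1},\psi_{m+1})$, $S_{mn}=(\phi_n',\phi_m')$ with $(\cdot,\cdot)$ the $L^2(-1,1)$ inner product, $L_n$ the Legendre polynomial of degree $n$, $P_n^{(-1,-1)}=\frac{n-1}{2(2n-1)}(L_n-L_{n-2})$ ($n\ge2$), $\psi_{m+1}=\frac{\sqrt{2(2m+1)}}{m}P_{m+1}^{(-1,-1)}$, $\phi_m=\sqrt{\frac{2m+1}{2}}L_m$. $I$ is the $(N-1)\times(N-1)$ identity and $\otimes$ the Kronecker product. ($A$ is the matrix of the divergence-free spectral Galerkin discretisation of the 2D curl-curl problem $\nabla\times\nabla\times\boldsymbol u+\kappa\boldsymbol u=\boldsymbol f$ in the basis $\{\boldsymbol\Phi_{m,n}\}$, and $\tilde A$ is obtained by replacing $S$ by $M^{-1}$.) *)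

theory Defs
  imports "HOL-Analysis.Analysis" "HOL-Computational_Algebra.Polynomial"
    "Jordan_Normal_Form.Gauss_Jordan_Elimination" "Jordan_Normal_Form.Matrix_Kernel"
begin

text \<open>Legendre polynomials, via Bonnet's recurrence
  (n+2) L_(n+2) = (2n+3) x L_(n+1) - (n+1) L_n, with L_0 = 1, L_1 = x.\<close>
fun legendre :: "nat \<Rightarrow> real poly" where
  "legendre 0 = 1"
| "legendre (Suc 0) = [:0, 1:]"
| "legendre (Suc (Suc n)) =
     Polynomial.smult (1 / real (n + 2))
       (Polynomial.smult (real (2 * n + 3)) ([:0, 1:] * legendre (Suc n)) - Polynomial.smult (real (n + 1)) (legendre n))"

definition l2ip :: "real poly \<Rightarrow> real poly \<Rightarrow> real" where
  "l2ip p q = integral {-1..1} (\<lambda>x. poly p x * poly q x)"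

text \<open>Jacobi polynomial P_n^(-1,-1) = (n-1)/(2(2n-1)) (L_n - L_(n-2)), used for n \<ge> 2.\<close>
definition jacobiP :: "nat \<Rightarrow> real poly" where
  "jacobiP n = Polynomial.smult ((real n - 1) / (2 * (2 * real n - 1))) (legendre n - legendre (n - 2))"

text \<open>psi_(m+1) = sqrt(2(2m+1))/m * P_(m+1)^(-1,-1)  (m \<ge> 1)\<close>
definition psi :: "nat \<Rightarrow> real poly" where
  "psi m = Polynomial.smult (sqrt (2 * (2 * real m + 1)) / real m) (jacobiP (m + 1))"

definition phi :: "nat \<Rightarrow> real poly" where
  "phi m = Polynomial.smult (sqrt ((2 * real m + 1) / 2)) (legendre m)"

text \<open>(N-1)x(N-1) matrices, row index m and column index n range over 1..N-1
  (matrix index i corresponds to m = i+1):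
  M_mn = (psi_(n+1), psi_(m+1)),  S_mn = (phi_n', phi_m').\<close>
definition Mmat :: "nat \<Rightarrow> real mat" where
  "Mmat N = mat (N - 1) (N - 1) (\<lambda>(i, j). l2ip (psi (j + 1)) (psi (i + 1)))"

definition Smat :: "nat \<Rightarrow> real mat" where
  "Smat N = mat (N - 1) (N - 1) (\<lambda>(i, j). l2ip (pderiv (phi (j + 1))) (pderiv (phi (i + 1))))"

definition kron :: "real mat \<Rightarrow> real mat \<Rightarrow> real mat" where
  "kron A B = mat (dim_row A * dim_row B) (dim_col A * dim_col B)
     (\<lambda>(i, j). A $$ (i div dim_row B, j div dim_col B) * B $$ (i mod dim_row B, j mod dim_col B))"

definition matinv :: "real mat \<Rightarrow> real mat" where
  "matinv A = the (mat_inverse A)"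

definition Atilde :: "nat \<Rightarrow> real \<Rightarrow> real mat" where
  "Atilde N \<kappa> = (let M = Mmat N; Mi = matinv M; I = 1\<^sub>m (N - 1) in
     kron M Mi + kron Mi M + 2 \<cdot>\<^sub>m kron I I + \<kappa> \<cdot>\<^sub>m (kron I M + kron M I))"

definition Amat :: "nat \<Rightarrow> real \<Rightarrow> real mat" where
  "Amat N \<kappa> = (let M = Mmat N; S = Smat N; I = 1\<^sub>m (N - 1) in
     kron M S + kron S M + 2 \<cdot>\<^sub>m kron I I + \<kappa> \<cdot>\<^sub>m (kron I M + kron M I))"

end

theory Submission
  imports Defs
begin

text \<open>Expand \<open>\<psi>_(m+1)\<close> and \<open>\<phi>_m'\<close> in the orthonormal polynomials \<open>\<phi>_k\<close>, with coefficient matrices \<open>C\<close>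
  and \<open>D\<close>.  Then \<open>M = C C\<^sup>T\<close> and \<open>S = D D\<^sup>T\<close>, and since \<open>\<psi>_(m+1)' = \<phi>_m\<close>, integration by parts becomes
  \<open>D C\<^sup>T = -I\<close>.  Hence \<open>X = S - inv(M)\<close> is itself a Gram matrix, so \<open>A - Atilde = M \<otimes> X + X \<otimes> M\<close> is a sum of two
  positive semidefinite matrices, and its kernel, which is the eigenspace in question, is
  \<open>ker X \<otimes> ker X\<close>.  As \<open>\<phi>_m'\<close> has degree less than \<open>m\<close>, cutting \<open>C\<close> off to its first \<open>N - 1\<close>
  columns gives \<open>inv(S)\<close> as a Gram matrix; \<open>M - inv(S)\<close> is then diagonal and nonzero exactly in the last two
  places, so that \<open>M X = (M - inv(S)) S\<close> has rank two.\<close>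

section \<open>Legendre polynomials\<close>

lemma legendre_bonnet:
  "real (n + 2) * poly (legendre (n + 2)) x =
     real (2 * n + 3) * x * poly (legendre (n + 1)) x - real (n + 1) * poly (legendre n) x"
  by (simp add: field_simps)

lemma pderiv_bonnet:
  "real (n + 2) * poly (pderiv (legendre (n + 2))) x =
     real (2 * n + 3) * (poly (legendre (n + 1)) x + x * poly (pderiv (legendre (n + 1))) x)
     - real (n + 1) * poly (pderiv (legendre n)) x"
  by (simp add: pderiv_smult pderiv_mult pderiv_diff pderiv_pCons field_simps)

text \<open>A joint induction: the second identity at \<open>n\<close>, put into the differentiated
  Bonnet recurrence, gives the first at \<open>n + 1\<close>; the second at \<open>n + 1\<close>
  then needs both hypotheses.\<close>

lemma legendre_pderiv_recurrences:
  "poly (pderiv (legendre (n + 1))) x =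
     x * poly (pderiv (legendre n)) x + real (n + 1) * poly (legendre n) x \<and>
   x * poly (pderiv (legendre (n + 1))) x - poly (pderiv (legendre n)) x =
     real (n + 1) * poly (legendre (n + 1)) x"
proof (induction n)
  case 0
  show ?case by (simp add: pderiv_pCons)
next
  case (Suc n)
  let ?L = "\<lambda>k. poly (legendre k) x" and ?D = "\<lambda>k. poly (pderiv (legendre k)) x"
  let ?r = "real n"
  have B: "(?r + 2) * ?L (n + 2) = (2 * ?r + 3) * x * ?L (n + 1) - (?r + 1) * ?L n"
    using legendre_bonnet[of n x] by (simp add: add.commute)
  have dB: "(?r + 2) * ?D (n + 2) = (2 * ?r + 3) * (?L (n + 1) + x * ?D (n + 1)) - (?r + 1) * ?D n"
    using pderiv_bonnet[of n x] by (simp add: add.commute)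
  have a: "?D (n + 1) = x * ?D n + (?r + 1) * ?L n"
    using conjunct1[OF Suc.IH] by (simp only: of_nat_add of_nat_1)
  have b: "x * ?D (n + 1) = ?D n + (?r + 1) * ?L (n + 1)"
    using conjunct2[OF Suc.IH] by (simp only: of_nat_add of_nat_1 diff_eq_eq add.commute)
  \<comment> \<open>The regrouping isolates \<open>x * ?D (n + 1) - ?D n\<close>, which
    \<open>b\<close> evaluates; the coefficient of \<open>?L (n + 1)\<close> then adds up to
    \<open>(?r + 2)^2\<close>.\<close>
  have "(?r + 2) * ?D (n + 2) = (2 * ?r + 3) * ?L (n + 1) + (?r + 2) * (x * ?D (n + 1))
      + (?r + 1) * (x * ?D (n + 1) - ?D n)"
    unfolding dB by (simp add: algebra_simps del: legendre.simps)
  also have "\<dots> = (?r + 2) * (x * ?D (n + 1) + (?r + 2) * ?L (n + 1))"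
    unfolding b by (simp add: algebra_simps power2_eq_square del: legendre.simps)
  finally have a': "?D (n + 2) = x * ?D (n + 1) + (?r + 2) * ?L (n + 1)"
    by (subst (asm) mult_left_cancel) auto
  have "x * ?D (n + 2) - ?D (n + 1) = x * (x * ?D (n + 1)) + (?r + 2) * (x * ?L (n + 1)) - ?D (n + 1)"
    unfolding a' by (simp add: algebra_simps del: legendre.simps)
  also have "\<dots> = (?r + 2) * ?L (n + 2)"
    unfolding b B using a by (simp add: algebra_simps del: legendre.simps)
  finally have b': "x * ?D (n + 2) - ?D (n + 1) = (?r + 2) * ?L (n + 2)" .
  from a' b' show ?case by (simp add: add.commute del: legendre.simps)
qed

text \<open>Obtained by eliminating x times the middle derivative from the two recurrences. It
  integrates Legendre polynomials and, telescoped, expands their derivatives.\<close>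

lemma legendre_eq_pderiv_diff:
  "pderiv (legendre (n + 2)) - pderiv (legendre n) = Polynomial.smult (2 * real n + 3) (legendre (n + 1))"
proof (rule poly_ext)
  fix x
  have a: "poly (pderiv (legendre (n + 2))) x =
      x * poly (pderiv (legendre (n + 1))) x + real (n + 2) * poly (legendre (n + 1)) x"
    using legendre_pderiv_recurrences[of "n + 1" x] by (simp only: add.assoc one_add_one)
  have b: "x * poly (pderiv (legendre (n + 1))) x =
      poly (pderiv (legendre n)) x + real (n + 1) * poly (legendre (n + 1)) x"
    using legendre_pderiv_recurrences[of n x] by linarith
  show "poly (pderiv (legendre (n + 2)) - pderiv (legendre n)) x =
      poly (Polynomial.smult (2 * real n + 3) (legendre (n + 1))) x"
    unfolding poly_diff poly_smult a b by (simp add: distrib_right del: legendre.simps)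
qed

lemma legendre_one: "poly (legendre n) 1 = 1"
proof (induction n rule: legendre.induct)
  case (3 n)
  then show ?case by (simp add: divide_simps)
qed simp_all

lemma legendre_minus_one: "poly (legendre n) (-1) = (-1) ^ n"
proof (induction n rule: legendre.induct)
  case (3 n)
  then show ?case by (simp add: field_simps)
qed simp_all

section \<open>The inner product on \<open>[-1, 1]\<close>\<close>

lemma l2ip_integrable: "(\<lambda>x. poly p x * poly q x) integrable_on {-1..1::real}"
  by (intro integrable_continuous_real continuous_intros)

lemma l2ip_commute: "l2ip p q = l2ip q p"
  by (simp add: l2ip_def mult.commute)

lemma l2ip_add_left: "l2ip (p + p') q = l2ip p q + l2ip p' q"
  unfolding l2ip_def poly_add distrib_right by (rule integral_add[OF l2ip_integrable l2ip_integrable])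

lemma l2ip_diff_left: "l2ip (p - p') q = l2ip p q - l2ip p' q"
  unfolding l2ip_def poly_diff left_diff_distrib by (rule integral_diff[OF l2ip_integrable l2ip_integrable])

lemma l2ip_smult_left: "l2ip (Polynomial.smult c p) q = c * l2ip p q"
  unfolding l2ip_def by (simp add: mult.assoc)

lemma l2ip_smult_right: "l2ip q (Polynomial.smult c p) = c * l2ip q p"
  by (simp only: l2ip_commute[of q] l2ip_smult_left)

lemma l2ip_sum_left: "l2ip (\<Sum>i\<in>A. f i) q = (\<Sum>i\<in>A. l2ip (f i) q)"
proof -
  have "l2ip 0 q = 0" by (simp add: l2ip_def)
  then show ?thesis
    by (induction A rule: infinite_finite_induct) (simp_all add: l2ip_add_left)
qed

lemma l2ip_sum_right: "l2ip q (\<Sum>i\<in>A. f i) = (\<Sum>i\<in>A. l2ip q (f i))"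
  by (simp only: l2ip_commute[of q] l2ip_sum_left)

section \<open>Orthogonality and norms of Legendre polynomials\<close>

lemma l2ip_X_mult: "l2ip ([:0, 1:] * p) q = l2ip p ([:0, 1:] * q)"
  by (simp only: l2ip_def poly_mult mult_ac)

lemma l2ip_pderiv_one: "l2ip (pderiv p) 1 = poly p 1 - poly p (-1)"
proof -
  have "((\<lambda>x. poly (pderiv p) x) has_integral (poly p 1 - poly p (-1))) {-1..1}"
    by (rule fundamental_theorem_of_calculus)
       (simp_all add: has_field_derivative_at_within poly_DERIV
         flip: has_real_derivative_iff_has_vector_derivative)
  then show ?thesis
    by (simp add: l2ip_def integral_unique)
qed

text \<open>Up to a factor, \<open>legendre n\<close> is the derivative of
  \<open>legendre (n + 1) - legendre (n - 1)\<close>, which vanishes at both endpoints because the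
  two indices have the same parity.\<close>

lemma l2ip_legendre_one:
  assumes "n \<ge> 1"
  shows "l2ip (legendre n) 1 = 0"
proof (cases n)
  case (Suc m)
  have "(2 * real m + 3) * l2ip (legendre (m + 1)) 1 = 0"
    by (subst l2ip_smult_left[symmetric], subst legendre_eq_pderiv_diff[symmetric])
       (simp add: l2ip_diff_left l2ip_pderiv_one legendre_one legendre_minus_one del: legendre.simps)
  then show ?thesis using Suc by (simp add: add_eq_0_iff)
qed (use assms in simp)

lemma l2ip_X_legendre:
  "real (2 * m + 3) * l2ip ([:0, 1:] * legendre (m + 1)) q =
     real (m + 2) * l2ip (legendre (m + 2)) q + real (m + 1) * l2ip (legendre m) q"
proof -
  have "Polynomial.smult (real (m + 2)) (legendre (m + 2)) =
      Polynomial.smult (real (2 * m + 3)) ([:0, 1:] * legendre (m + 1)) - Polynomial.smult (real (m + 1)) (legendre m)"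
    by (simp add: smult_diff_right del: mult_pCons_left)
  from arg_cong[OF this, of "\<lambda>p. l2ip p q"] show ?thesis
    by (simp only: l2ip_smult_left l2ip_diff_left)
qed

text \<open>Bonnet lowers the smaller index at the price of a factor x. Moved to the other side,
  this factor turns \<open>legendre n\<close> into its two neighbours, whose indices still exceed
  the smaller one.\<close>

lemma l2ip_legendre_less: "m < n \<Longrightarrow> l2ip (legendre m) (legendre n) = 0"
proof (induction m arbitrary: n rule: legendre.induct)
  case 1
  then show ?case by (simp add: l2ip_commute[of 1] l2ip_legendre_one)
next
  case 2
  then obtain k where n: "n = k + 2" by (auto simp: less_iff_Suc_add)
  have "real (2 * (k + 1) + 3) * l2ip ([:0, 1:] * legendre (k + 1 + 1)) 1 = 0"
    unfolding l2ip_X_legendre by (simp add: l2ip_legendre_one del: legendre.simps)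
  then have "l2ip ([:0, 1:] * legendre n) 1 = 0"
    by (simp add: n add_eq_0_iff del: legendre.simps mult_pCons_left)
  then show ?case
    using l2ip_X_mult[of 1 "legendre n"] by (simp add: l2ip_commute[of 1] del: mult_pCons_left)
next
  case (3 m)
  then obtain k where n: "n = k + 1" and k: "m + 1 < k" by (cases n) auto
  have "real (2 * k + 3) * l2ip ([:0, 1:] * legendre (k + 1)) (legendre (Suc m)) = 0"
    unfolding l2ip_X_legendre
    using "3.IH"(1)[of "k + 2"] "3.IH"(1)[of k] k
    by (simp add: l2ip_commute[of _ "legendre (Suc m)"] del: legendre.simps)
  then have "l2ip (legendre (Suc m)) ([:0, 1:] * legendre n) = 0"
    by (simp add: n add_eq_0_iff l2ip_commute[of _ "legendre (Suc m)"] del: legendre.simps mult_pCons_left)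
  moreover have "l2ip (legendre m) (legendre n) = 0"
    using "3.IH"(2)[of n] "3.prems" by simp
  ultimately show ?case
    using l2ip_X_legendre[of m "legendre n"]
    by (simp add: l2ip_X_mult add_eq_0_iff del: legendre.simps mult_pCons_left)
qed

text \<open>Bonnet applied to either factor of the pairing of x times \<open>legendre n\<close> with
  \<open>legendre (n + 1)\<close> relates consecutive squared norms.\<close>

lemma l2ip_legendre_self: "(2 * real n + 1) * l2ip (legendre n) (legendre n) = 2"
proof (induction n)
  case 0
  show ?case by (simp add: l2ip_def)
next
  case (Suc n)
  let ?I = "\<lambda>i j. l2ip (legendre i) (legendre j)"
  \<comment> \<open>The case \<open>n = 0\<close> is separate because Bonnet expresses x times
    \<open>legendre n\<close> only for positive \<open>n\<close>.\<close>
  have h1: "(2 * real n + 1) * l2ip ([:0, 1:] * legendre n) (legendre (n + 1)) = (real n + 1) * ?I (n + 1) (n + 1)"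
  proof (cases n)
    case 0
    then show ?thesis by simp
  next
    case (Suc m)
    then have n: "n = m + 1" and e: "2 * real n + 1 = real (2 * m + 3)" "real n + 1 = real (m + 2)"
      "n + 1 = m + 2" by auto
    have z: "l2ip (legendre m) (legendre (m + 2)) = 0"
      by (rule l2ip_legendre_less) simp
    show ?thesis
      using l2ip_X_legendre[of m "legendre (m + 2)"] unfolding e z unfolding n by linarith
  qed
  have h2: "(2 * real n + 3) * l2ip ([:0, 1:] * legendre (n + 1)) (legendre n) = (real n + 1) * ?I n n"
  proof -
    have z: "l2ip (legendre (n + 2)) (legendre n) = 0"
      unfolding l2ip_commute[of "legendre (n + 2)"] by (rule l2ip_legendre_less) simp
    have e: "2 * real n + 3 = real (2 * n + 3)" "real n + 1 = real (n + 1)" by auto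
    show ?thesis
      using l2ip_X_legendre[of n "legendre n"] unfolding e z by linarith
  qed
  have h3: "l2ip ([:0, 1:] * legendre (n + 1)) (legendre n) = l2ip ([:0, 1:] * legendre n) (legendre (n + 1))"
    by (metis l2ip_X_mult l2ip_commute)
  have "(real n + 1) * ((2 * real n + 3) * ?I (n + 1) (n + 1))
      = (2 * real n + 3) * ((2 * real n + 1) * l2ip ([:0, 1:] * legendre n) (legendre (n + 1)))"
    unfolding h1 by (rule mult.left_commute)
  also have "\<dots> = (2 * real n + 1) * ((2 * real n + 3) * l2ip ([:0, 1:] * legendre (n + 1)) (legendre n))"
    unfolding h3 by (rule mult.left_commute)
  also have "\<dots> = (real n + 1) * ((2 * real n + 1) * ?I n n)"
    unfolding h2 by (rule mult.left_commute)
  finally have "(2 * real n + 3) * ?I (n + 1) (n + 1) = (2 * real n + 1) * ?I n n"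
    by (subst (asm) mult_left_cancel) auto
  then show ?case using Suc.IH by (simp add: add.commute del: legendre.simps)
qed

lemma l2ip_phi: "l2ip (phi m) (phi n) = (if m = n then 1 else 0)"
proof (cases "m = n")
  case True
  have "sqrt ((2 * real n + 1) / 2) * sqrt ((2 * real n + 1) / 2) = (2 * real n + 1) / 2"
    by simp
  with True l2ip_legendre_self[of n] show ?thesis
    by (simp add: phi_def l2ip_smult_left l2ip_smult_right mult.assoc[symmetric])
next
  case False
  then have "l2ip (legendre m) (legendre n) = 0"
    using l2ip_legendre_less[of m n] l2ip_legendre_less[of n m] l2ip_commute by (cases m n rule: linorder_cases) auto
  with False show ?thesis by (simp add: phi_def l2ip_smult_left l2ip_smult_right)
qed

section \<open>Expansions in the orthonormal basis \<open>phi\<close>\<close>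

lemma smult_sum_right: "Polynomial.smult c (\<Sum>i\<in>A. f i) = (\<Sum>i\<in>A. Polynomial.smult c (f i))"
  by (induction A rule: infinite_finite_induct) (simp_all add: smult_add_right)

text \<open>Coefficients in the orthonormal basis \<open>phi 0, phi 1, \<dots>\<close>.  Recall that \<open>psi m\<close> is the paper's
  \<open>\<psi>_(m+1)\<close>, so that \<open>phi m\<close> is its derivative.\<close>

definition psi_coeff :: "nat \<Rightarrow> nat \<Rightarrow> real" where
  "psi_coeff m k =
     (if k = m + 1 then 1 / sqrt ((2 * real m + 1) * (2 * real m + 3))
      else if k + 1 = m then - 1 / sqrt ((2 * real m + 1) * (2 * real m - 1)) else 0)"

definition dphi_coeff :: "nat \<Rightarrow> nat \<Rightarrow> real" where
  "dphi_coeff m k =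
     (if k < m \<and> odd (m - k) then sqrt ((2 * real m + 1) * (2 * real k + 1)) else 0)"

lemma psi_eq_legendre_diff:
  assumes "m \<ge> 1"
  shows "psi m = Polynomial.smult (1 / sqrt (2 * (2 * real m + 1))) (legendre (m + 1) - legendre (m - 1))"
proof -
  define b where "b = 2 * (2 * real m + 1)"
  have "b > 0" by (simp add: b_def)
  then have "sqrt b / b = 1 / sqrt b"
    by (simp add: frac_eq_eq)
  moreover have "sqrt (2 * (2 * real m + 1)) / real m * ((real (m + 1) - 1) / (2 * (2 * real (m + 1) - 1))) = sqrt b / b"
    using assms by (simp add: b_def)
  moreover have "m + 1 - 2 = m - 1" by simp
  ultimately show ?thesis
    unfolding psi_def jacobiP_def smult_smult b_def by simp
qed

lemma inverse_sqrt_mult_sqrt_half: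
  "b > 0 \<Longrightarrow> 1 / sqrt (a * b) * sqrt (b / 2) = 1 / sqrt (2 * a)"
  by (simp add: real_sqrt_mult real_sqrt_divide)

lemma psi_coeff_Suc_mult_sqrt:
  "psi_coeff m (m + 1) * sqrt ((2 * real (m + 1) + 1) / 2) = 1 / sqrt (2 * (2 * real m + 1))"
proof -
  have "2 * real (m + 1) + 1 = 2 * real m + 3" by simp
  then show ?thesis
    using inverse_sqrt_mult_sqrt_half[of "2 * real m + 3" "2 * real m + 1"]
    by (simp only: psi_coeff_def) simp
qed

lemma psi_coeff_pred_mult_sqrt:
  assumes "m \<ge> 1"
  shows "psi_coeff m (m - 1) * sqrt ((2 * real (m - 1) + 1) / 2) = - 1 / sqrt (2 * (2 * real m + 1))"
proof -
  have "2 * real (m - 1) + 1 = 2 * real m - 1" using assms by (simp add: of_nat_diff)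
  moreover have "psi_coeff m (m - 1) = - (1 / sqrt ((2 * real m + 1) * (2 * real m - 1)))"
    using assms by (cases m) (simp_all add: psi_coeff_def)
  ultimately show ?thesis
    using inverse_sqrt_mult_sqrt_half[of "2 * real m - 1" "2 * real m + 1"] assms
    by (simp only: mult_minus_left)
qed

lemma psi_eq_sum_phi:
  assumes "m \<ge> 1" "m + 1 < d"
  shows "psi m = (\<Sum>k<d. Polynomial.smult (psi_coeff m k) (phi k))"
proof -
  have "(\<Sum>k<d. Polynomial.smult (psi_coeff m k) (phi k)) = (\<Sum>k\<in>{m - 1, m + 1}. Polynomial.smult (psi_coeff m k) (phi k))"
    using assms by (intro sum.mono_neutral_right) (auto simp: psi_coeff_def)
  also have "\<dots> = Polynomial.smult (psi_coeff m (m - 1)) (phi (m - 1)) + Polynomial.smult (psi_coeff m (m + 1)) (phi (m + 1))"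
    by simp
  also have "\<dots> = psi m"
    unfolding phi_def smult_smult psi_coeff_Suc_mult_sqrt psi_coeff_pred_mult_sqrt[OF assms(1)]
      psi_eq_legendre_diff[OF assms(1)]
    by (simp add: smult_diff_right)
  finally show ?thesis by simp
qed

text \<open>Telescoping \<open>legendre_eq_pderiv_diff\<close> in steps of two. The fixed range with
  a condition inside lets each step add a term without changing the range.\<close>

lemma pderiv_legendre_eq_sum:
  "m \<le> d \<Longrightarrow> pderiv (legendre m) =
     (\<Sum>k<d. if k < m \<and> odd (m - k) then Polynomial.smult (2 * real k + 1) (legendre k) else 0)"
proof (induction m rule: legendre.induct)
  case 1
  then show ?case by simp
next
  case 2
  have "(\<Sum>k<d. if k < Suc 0 \<and> odd (Suc 0 - k) then Polynomial.smult (2 * real k + 1) (legendre k) else 0)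
      = (\<Sum>k\<in>{0}. if k < Suc 0 \<and> odd (Suc 0 - k) then Polynomial.smult (2 * real k + 1) (legendre k) else 0)"
    using 2 by (intro sum.mono_neutral_right) auto
  then show ?case by (simp add: pderiv_pCons)
next
  case (3 m)
  let ?f = "\<lambda>m k. if k < m \<and> odd (m - k) then Polynomial.smult (2 * real k + 1) (legendre k) else 0"
  \<comment> \<open>Parity is unchanged from \<open>m\<close> to \<open>m + 2\<close>, so only
    \<open>k = m + 1\<close> is new; \<open>k = m\<close> fails because its difference is
    even.\<close>
  have split: "?f (m + 2) k = ?f m k + (if k = m + 1 then Polynomial.smult (2 * real m + 3) (legendre (m + 1)) else 0)" for k
    by (cases "k < m"; cases "k = m"; cases "k = m + 1") (auto simp: Suc_diff_le add.commute)
  have "pderiv (legendre (m + 2)) = pderiv (legendre m) + Polynomial.smult (2 * real m + 3) (legendre (m + 1))"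
    unfolding legendre_eq_pderiv_diff[symmetric] by simp
  also have "pderiv (legendre m) = sum (?f m) {..<d}"
    using "3.IH" "3.prems" by simp
  also have "Polynomial.smult (2 * real m + 3) (legendre (m + 1)) =
      (\<Sum>k<d. if k = m + 1 then Polynomial.smult (2 * real m + 3) (legendre (m + 1)) else 0)"
    using "3.prems" by (subst sum.delta) auto
  also have "sum (?f m) {..<d} + \<dots> = sum (?f (m + 2)) {..<d}"
    unfolding split sum.distrib ..
  finally show ?case by (simp del: legendre.simps)
qed

lemma pderiv_phi_eq_sum_phi:
  assumes "m \<le> d"
  shows "pderiv (phi m) = (\<Sum>k<d. Polynomial.smult (dphi_coeff m k) (phi k))"
proof -
  have "pderiv (phi m) = (\<Sum>k<d. Polynomial.smult (sqrt ((2 * real m + 1) / 2))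
      (if k < m \<and> odd (m - k) then Polynomial.smult (2 * real k + 1) (legendre k) else 0))"
    by (simp only: phi_def pderiv_smult pderiv_legendre_eq_sum[OF assms] smult_sum_right)
  also have "\<dots> = (\<Sum>k<d. Polynomial.smult (dphi_coeff m k) (phi k))"
  proof (rule sum.cong)
    fix k
    have "sqrt ((2 * real m + 1) * (2 * real k + 1)) * sqrt ((2 * real k + 1) / 2)
        = sqrt ((2 * real m + 1) / 2) * (2 * real k + 1)"
      by (simp add: real_sqrt_mult real_sqrt_divide)
    then show "Polynomial.smult (sqrt ((2 * real m + 1) / 2))
      (if k < m \<and> odd (m - k) then Polynomial.smult (2 * real k + 1) (legendre k) else 0)
       = Polynomial.smult (dphi_coeff m k) (phi k)"
      by (simp add: dphi_coeff_def phi_def)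
  qed simp
  finally show ?thesis .
qed

text \<open>Parseval's identity, which turns the integrals in \<open>Mmat\<close> and
  \<open>Smat\<close> into products of coefficient rows.\<close>

lemma l2ip_sum_phi:
  "l2ip (\<Sum>k<d. Polynomial.smult (a k) (phi k)) (\<Sum>k<d. Polynomial.smult (b k) (phi k)) = (\<Sum>k<d. a k * b k)"
proof -
  have "l2ip (phi k) (\<Sum>j<d. Polynomial.smult (b j) (phi j)) = b k" if "k < d" for k
  proof -
    have "l2ip (phi k) (\<Sum>j<d. Polynomial.smult (b j) (phi j)) = (\<Sum>j<d. if j = k then b j else 0)"
      unfolding l2ip_sum_right l2ip_smult_right l2ip_phi by (intro sum.cong) auto
    then show ?thesis using that by simp
  qed
  then show ?thesis
    unfolding l2ip_sum_left l2ip_smult_left by simp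
qed

text \<open>The two terms of \<open>psi m\<close> contribute opposite amounts when both degrees
  occur in the derivative of \<open>phi n\<close>; only for \<open>m = n\<close> does the lower one
  remain alone. This is integration by parts in coefficients.\<close>

lemma sum_psi_coeff_mult_dphi_coeff:
  assumes "m \<ge> 1" "m + 1 < d"
  shows "(\<Sum>k<d. psi_coeff m k * dphi_coeff n k) = (if m = n then - 1 else 0)"
proof -
  have "(\<Sum>k<d. psi_coeff m k * dphi_coeff n k) = (\<Sum>k\<in>{m - 1, m + 1}. psi_coeff m k * dphi_coeff n k)"
    using assms by (intro sum.mono_neutral_right) (auto simp: psi_coeff_def)
  also have "\<dots> = psi_coeff m (m - 1) * dphi_coeff n (m - 1) + psi_coeff m (m + 1) * dphi_coeff n (m + 1)"
    by simp
  also have "psi_coeff m (m + 1) * dphi_coeff n (m + 1) =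
      (if m + 1 < n \<and> odd (n - (m + 1)) then sqrt (2 * real n + 1) / sqrt (2 * real m + 1) else 0)"
  proof -
    have "sqrt (2 * real m + 3) \<noteq> 0" by simp
    then show ?thesis
      by (simp add: psi_coeff_def dphi_coeff_def real_sqrt_mult add.commute)
  qed
  also have "psi_coeff m (m - 1) * dphi_coeff n (m - 1) =
      (if m - 1 < n \<and> odd (n - (m - 1)) then - (sqrt (2 * real n + 1) / sqrt (2 * real m + 1)) else 0)"
  proof -
    obtain r where m: "m = Suc r" using assms by (cases m) auto
    have "sqrt (2 * real r + 1) \<noteq> 0" by simp
    then show ?thesis unfolding m
      by (simp add: psi_coeff_def dphi_coeff_def real_sqrt_mult add.commute)
  qed
  \<comment> \<open>At \<open>n = m + 1\<close> the difference from \<open>m - 1\<close> is 2, hence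
    even, so the lower term occurs without the upper one only at \<open>n = m\<close>.\<close>
  also have "m - 1 < n \<and> odd (n - (m - 1)) \<longleftrightarrow> m = n \<or> m + 1 < n \<and> odd (n - (m + 1))"
    using assms(1) by (auto; presburger)
  finally show ?thesis by auto
qed

section \<open>Kronecker products and positive semidefinite matrices\<close>

lemma sum_div_mod:
  fixes f :: "nat \<Rightarrow> nat \<Rightarrow> 'a :: comm_monoid_add"
  shows "(\<Sum>k<a * b. f (k div b) (k mod b)) = (\<Sum>i<a. \<Sum>j<b. f i j)"
proof -
  have "(\<Sum>k<a * b. f (k div b) (k mod b)) = (\<Sum>i<a. \<Sum>k=i * b..<i * b + b. f (k div b) (k mod b))"
    by (rule sum.nat_group[symmetric])
  also have "\<dots> = (\<Sum>i<a. \<Sum>j<b. f i j)"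
  proof (rule sum.cong[OF refl])
    fix i
    have *: "f i (k - i * b) = f (k div b) (k mod b)" if ge: "i * b \<le> k" and lt: "k < i * b + b" for k
    proof -
      obtain j where "k = i * b + j" using le_Suc_ex[OF ge] by auto
      then show ?thesis using lt by simp
    qed
    show "(\<Sum>k=i * b..<i * b + b. f (k div b) (k mod b)) = (\<Sum>j<b. f i j)"
      by (rule sum.reindex_bij_witness[of _ "\<lambda>j. i * b + j" "\<lambda>k. k - i * b"]) (auto intro: *)
  qed
  finally show ?thesis .
qed

lemma div_less_of_less_mult: "i < a * b \<Longrightarrow> i div b < a" for i a b :: nat
  by (simp add: less_mult_imp_div_less)

lemma mod_less_of_less_mult: "i < a * b \<Longrightarrow> i mod b < b" for i a b :: nat
  by (metis mod_less_divisor mult_0_right not_gr_zero not_less_zero)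

lemma kron_carrier:
  "A \<in> carrier_mat a b \<Longrightarrow> B \<in> carrier_mat c d \<Longrightarrow> kron A B \<in> carrier_mat (a * c) (b * d)"
  by (auto simp: kron_def)

lemma kron_index:
  assumes "A \<in> carrier_mat a b" "B \<in> carrier_mat c d" "i < a * c" "j < b * d"
  shows "kron A B $$ (i, j) = A $$ (i div c, j div d) * B $$ (i mod c, j mod d)"
  using assms by (simp add: kron_def)

text \<open>The sum over the composite inner index splits by quotient and remainder into a product
  of two sums.\<close>

lemma kron_mult:
  assumes A: "A \<in> carrier_mat a b" and B: "B \<in> carrier_mat c d"
    and C: "C \<in> carrier_mat b e" and D: "D \<in> carrier_mat d f"
  shows "kron A B * kron C D = kron (A * C) (B * D)"
proof (rule eq_matI)
  have AC: "A * C \<in> carrier_mat a e" and BD: "B * D \<in> carrier_mat c f" using assms by auto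
  note AB' = kron_carrier[OF A B] and CD' = kron_carrier[OF C D] and K = kron_carrier[OF AC BD]
  show "dim_row (kron A B * kron C D) = dim_row (kron (A * C) (B * D))"
    "dim_col (kron A B * kron C D) = dim_col (kron (A * C) (B * D))"
    using AB' CD' K by auto
  fix i j
  assume "i < dim_row (kron (A * C) (B * D))" "j < dim_col (kron (A * C) (B * D))"
  then have i: "i < a * c" and j: "j < e * f" using K by auto
  note i' = div_less_of_less_mult[OF i] mod_less_of_less_mult[OF i]
  note j' = div_less_of_less_mult[OF j] mod_less_of_less_mult[OF j]
  have "(kron A B * kron C D) $$ (i, j) = (\<Sum>k<b * d. kron A B $$ (i, k) * kron C D $$ (k, j))"
    using AB' CD' i j by (simp add: scalar_prod_def lessThan_atLeast0)
  also have "\<dots> = (\<Sum>k<b * d. (A $$ (i div c, k div d) * B $$ (i mod c, k mod d)) *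
      (C $$ (k div d, j div f) * D $$ (k mod d, j mod f)))"
    by (intro sum.cong refl) (simp add: kron_index[OF A B i] kron_index[OF C D _ j])
  also have "\<dots> = (\<Sum>p<b. \<Sum>q<d. (A $$ (i div c, p) * B $$ (i mod c, q)) *
      (C $$ (p, j div f) * D $$ (q, j mod f)))"
    by (rule sum_div_mod)
  also have "\<dots> = (\<Sum>p<b. A $$ (i div c, p) * C $$ (p, j div f)) * (\<Sum>q<d. B $$ (i mod c, q) * D $$ (q, j mod f))"
    by (simp add: sum_product mult_ac)
  also have "\<dots> = (A * C) $$ (i div c, j div f) * (B * D) $$ (i mod c, j mod f)"
    using A B C D i' j' by (simp add: scalar_prod_def lessThan_atLeast0)
  also have "\<dots> = kron (A * C) (B * D) $$ (i, j)"
    by (simp add: kron_index[OF AC BD i j])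
  finally show "(kron A B * kron C D) $$ (i, j) = kron (A * C) (B * D) $$ (i, j)" .
qed

lemma kron_transpose: "(kron A B)\<^sup>T = kron A\<^sup>T B\<^sup>T"
  by (rule eq_matI) (auto simp: kron_def div_less_of_less_mult mod_less_of_less_mult)

lemma kron_diff_left:
  assumes A: "A \<in> carrier_mat a b" and A': "A' \<in> carrier_mat a b" and B: "B \<in> carrier_mat c d"
  shows "kron (A - A') B = kron A B - kron A' B"
  using assms
  by (intro eq_matI) (auto simp: kron_def div_less_of_less_mult mod_less_of_less_mult left_diff_distrib)

lemma kron_diff_right:
  assumes A: "A \<in> carrier_mat a b" and B: "B \<in> carrier_mat c d" and B': "B' \<in> carrier_mat c d"
  shows "kron A (B - B') = kron A B - kron A B'"
  using assms
  by (intro eq_matI) (auto simp: kron_def div_less_of_less_mult mod_less_of_less_mult right_diff_distrib)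

lemma kron_one_mat_diag: "kron (1\<^sub>m a) (mat_diag b d) = mat_diag (a * b) (\<lambda>i. d (i mod b))"
proof (rule eq_matI)
  fix i j assume "i < dim_row (mat_diag (a * b) (\<lambda>i. d (i mod b)))" "j < dim_col (mat_diag (a * b) (\<lambda>i. d (i mod b)))"
  then have i: "i < a * b" and j: "j < a * b" by (simp_all add: mat_diag_def)
  have "i div b = j div b \<and> i mod b = j mod b \<longleftrightarrow> i = j"
    by (metis div_mult_mod_eq)
  then show "kron (1\<^sub>m a) (mat_diag b d) $$ (i, j) = mat_diag (a * b) (\<lambda>i. d (i mod b)) $$ (i, j)"
    using i j by (auto simp: kron_def mat_diag_def div_less_of_less_mult mod_less_of_less_mult)
qed (auto simp: kron_def mat_diag_def)

lemma kron_mat_diag_one: "kron (mat_diag a d) (1\<^sub>m b) = mat_diag (a * b) (\<lambda>i. d (i div b))"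
proof (rule eq_matI)
  fix i j assume "i < dim_row (mat_diag (a * b) (\<lambda>i. d (i div b)))" "j < dim_col (mat_diag (a * b) (\<lambda>i. d (i div b)))"
  then have i: "i < a * b" and j: "j < a * b" by (simp_all add: mat_diag_def)
  have "i div b = j div b \<and> i mod b = j mod b \<longleftrightarrow> i = j"
    by (metis div_mult_mod_eq)
  then show "kron (mat_diag a d) (1\<^sub>m b) $$ (i, j) = mat_diag (a * b) (\<lambda>i. d (i div b)) $$ (i, j)"
    using i j by (auto simp: kron_def mat_diag_def div_less_of_less_mult mod_less_of_less_mult)
qed (auto simp: kron_def mat_diag_def)

section \<open>Kernels of diagonal matrices\<close>

lemma mat_diag_mult_vec_index:
  fixes v :: "'a :: semiring_1 vec"
  assumes "v \<in> carrier_vec n" "i < n"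
  shows "(mat_diag n d *\<^sub>v v) $ i = d i * v $ i"
proof -
  have "(mat_diag n d *\<^sub>v v) $ i = (\<Sum>j<n. (if i = j then d j else 0) * v $ j)"
    using assms by (simp add: mat_diag_def scalar_prod_def lessThan_atLeast0)
  also have "\<dots> = (\<Sum>j<n. if i = j then d j * v $ j else 0)"
    by (intro sum.cong) auto
  finally show ?thesis using assms by simp
qed

lemma mat_diag_mult_vec_eq_0:
  fixes w :: "'a :: idom vec"
  assumes "w \<in> carrier_vec n"
  shows "mat_diag n d *\<^sub>v w = 0\<^sub>v n \<longleftrightarrow> (\<forall>i<n. d i = 0 \<or> w $ i = 0)"
proof -
  have "dim_vec (mat_diag n d *\<^sub>v w) = n" by (simp add: mat_diag_def)
  then show ?thesis
    using assms by (auto simp: vec_eq_iff mat_diag_mult_vec_index simp del: index_mult_mat_vec)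
qed

section \<open>Gram matrices and their kernels\<close>

lemma scalar_prod_self_nonneg: "0 \<le> v \<bullet> v" for v :: "real vec"
  by (simp add: scalar_prod_def sum_nonneg)

lemma scalar_prod_self_eq_0:
  fixes v :: "real vec"
  assumes "v \<in> carrier_vec n" "v \<bullet> v = 0"
  shows "v = 0\<^sub>v n"
proof (rule eq_vecI)
  fix i assume "i < dim_vec (0\<^sub>v n :: real vec)"
  then show "v $ i = 0\<^sub>v n $ i"
    using assms by (auto simp: scalar_prod_def sum_nonneg_eq_0_iff)
qed (use assms in auto)

lemma scalar_prod_gram:
  fixes Z :: "real mat"
  assumes Z: "Z \<in> carrier_mat n a" and v: "v \<in> carrier_vec n"
  shows "v \<bullet> (Z * Z\<^sup>T *\<^sub>v v) = (Z\<^sup>T *\<^sub>v v) \<bullet> (Z\<^sup>T *\<^sub>v v)"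
  using transpose_vec_mult_scalar[of Z n a "Z\<^sup>T *\<^sub>v v" v] assms by simp

lemma gram_mult_vec_eq_0:
  fixes Z :: "real mat"
  assumes Z: "Z \<in> carrier_mat n a" and v: "v \<in> carrier_vec n" and "Z * Z\<^sup>T *\<^sub>v v = 0\<^sub>v n"
  shows "Z\<^sup>T *\<^sub>v v = 0\<^sub>v a"
  using scalar_prod_gram[OF Z v] assms scalar_prod_self_eq_0[of "Z\<^sup>T *\<^sub>v v" a] by simp

text \<open>Pairing with \<open>v\<close> gives the sum of the squared lengths of
  \<open>Z\<^sup>T *\<^sub>v v\<close> and \<open>W\<^sup>T *\<^sub>v v\<close>, so both vectors
  vanish.\<close>

lemma gram_add_mult_vec_eq_0:
  fixes Z W :: "real mat"
  assumes Z: "Z \<in> carrier_mat n a" and W: "W \<in> carrier_mat n b" and v: "v \<in> carrier_vec n"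
    and eq: "(Z * Z\<^sup>T + W * W\<^sup>T) *\<^sub>v v = 0\<^sub>v n"
  shows "Z * Z\<^sup>T *\<^sub>v v = 0\<^sub>v n" "W * W\<^sup>T *\<^sub>v v = 0\<^sub>v n"
proof -
  have ZZ: "Z * Z\<^sup>T \<in> carrier_mat n n" and WW: "W * W\<^sup>T \<in> carrier_mat n n" using Z W by auto
  have "v \<bullet> (Z * Z\<^sup>T *\<^sub>v v) + v \<bullet> (W * W\<^sup>T *\<^sub>v v) = v \<bullet> ((Z * Z\<^sup>T + W * W\<^sup>T) *\<^sub>v v)"
    using ZZ WW v by (simp only: add_mult_distrib_mat_vec[OF ZZ WW v]) (simp add: scalar_prod_add_distrib[of _ n])
  then have "(Z\<^sup>T *\<^sub>v v) \<bullet> (Z\<^sup>T *\<^sub>v v) + (W\<^sup>T *\<^sub>v v) \<bullet> (W\<^sup>T *\<^sub>v v) = 0"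
    using v unfolding eq scalar_prod_gram[OF Z v] scalar_prod_gram[OF W v] by simp
  then have "(Z\<^sup>T *\<^sub>v v) \<bullet> (Z\<^sup>T *\<^sub>v v) = 0" "(W\<^sup>T *\<^sub>v v) \<bullet> (W\<^sup>T *\<^sub>v v) = 0"
    using scalar_prod_self_nonneg[of "Z\<^sup>T *\<^sub>v v"] scalar_prod_self_nonneg[of "W\<^sup>T *\<^sub>v v"] by linarith+
  then have "Z\<^sup>T *\<^sub>v v = 0\<^sub>v a" "W\<^sup>T *\<^sub>v v = 0\<^sub>v b"
    using Z W v by (auto intro!: scalar_prod_self_eq_0)
  moreover have "Z *\<^sub>v 0\<^sub>v a = 0\<^sub>v n" "W *\<^sub>v 0\<^sub>v b = 0\<^sub>v n"
    using Z W by auto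
  ultimately show "Z * Z\<^sup>T *\<^sub>v v = 0\<^sub>v n" "W * W\<^sup>T *\<^sub>v v = 0\<^sub>v n"
    using Z W v by (simp_all add: assoc_mult_mat_vec[of _ n a _ n] assoc_mult_mat_vec[of _ n b _ n])
qed

lemma matinv_inverse:
  assumes A: "A \<in> carrier_mat n n" and "invertible_mat A"
  shows "A * matinv A = 1\<^sub>m n" "matinv A * A = 1\<^sub>m n" "matinv A \<in> carrier_mat n n"
proof -
  obtain B where B: "A * B = 1\<^sub>m n" "B * A = 1\<^sub>m (dim_row B)"
    using assms by (auto simp: invertible_mat_def inverts_mat_def)
  \<comment> \<open>\<open>invertible_mat\<close> does not fix the shape of \<open>B\<close>;
    comparing column counts in the two identities does.\<close>
  have "dim_col B = n" using arg_cong[OF B(1), of dim_col] by simp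
  moreover have "dim_row B = n" using arg_cong[OF B(2), of dim_col] A by simp
  ultimately have "A \<in> Units (ring_mat TYPE(real) n ())"
    using A B by (auto simp: Units_def ring_mat_def intro!: exI[of _ B] bexI[of _ B])
  then obtain B' where "mat_inverse A = Some B'"
    using mat_inverse(1)[OF A, of "()"] by fastforce
  with mat_inverse(2)[OF A this]
  show "A * matinv A = 1\<^sub>m n" "matinv A * A = 1\<^sub>m n" "matinv A \<in> carrier_mat n n"
    by (auto simp: matinv_def)
qed

text \<open>The unit vectors with index in \<open>J\<close> form a basis of the kernel.\<close>

lemma kernel_dim_coordinate_subspace:
  fixes A :: "'a :: field mat"
  assumes A: "A \<in> carrier_mat nr n" and J: "J \<subseteq> {..<n}"
    and ker: "\<And>v. v \<in> carrier_vec n \<Longrightarrow> A *\<^sub>v v = 0\<^sub>v nr \<longleftrightarrow> (\<forall>i<n. i \<notin> J \<longrightarrow> v $ i = 0)"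
  shows "kernel_dim A = card J"
proof -
  interpret kernel nr n A by (unfold_locales, rule A)
  let ?B = "unit_vec n ` J :: 'a vec set"
  have fin: "finite ?B" using J finite_subset by blast
  have inj: "inj_on (unit_vec n :: nat \<Rightarrow> 'a vec) J"
    using J by (auto simp: inj_on_def)
  have sub: "?B \<subseteq> mat_kernel A"
    using J by (auto simp: mat_kernel[OF A] ker)
  have index: "lincomb a ?B $ i = (if i \<in> J then a (unit_vec n i) else 0)" if "i < n" for a i
  proof -
    have "lincomb a ?B $ i = (\<Sum>x\<in>?B. a x * x $ i)" by (rule lincomb_index[OF that sub])
    also have "\<dots> = (\<Sum>j\<in>J. if j = i then a (unit_vec n j) else 0)"
      using that J by (subst sum.reindex[OF inj]) (auto intro!: sum.cong)
    finally show ?thesis using finite_subset[OF J] by simp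
  qed
  have "basis ?B"
    unfolding Ker.basis_def
  proof (intro conjI)
    show "span ?B = mat_kernel A"
    proof
      show "span ?B \<subseteq> mat_kernel A" using Ker.span_is_subset2[OF sub] by simp
      show "mat_kernel A \<subseteq> span ?B"
      proof
        fix v assume v: "v \<in> mat_kernel A"
        then have vc: "v \<in> carrier_vec n" and v0: "\<And>i. i < n \<Longrightarrow> i \<notin> J \<Longrightarrow> v $ i = 0"
          using ker by (auto simp: mat_kernel[OF A])
        \<comment> \<open>The coefficient of a unit vector is the entry of \<open>v\<close> at its
          index, which \<open>the_inv_into\<close> recovers.\<close>
        define a where "a u = v $ (the_inv_into J (unit_vec n) u)" for u :: "'a vec"
        have "lincomb a ?B \<in> carrier_vec n"
          using Ker.lincomb_closed[OF sub, of a] mat_kernel_carrier[OF A] by auto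
        then have "v = lincomb a ?B"
          using vc v0 by (intro eq_vecI) (simp_all add: index a_def the_inv_into_f_f[OF inj])
        then show "v \<in> span ?B" unfolding Ker.span_def using fin by auto
      qed
    qed
    have "a v = 0" if 0: "lincomb a ?B = 0\<^sub>v n" and v: "v \<in> ?B" for a v
    proof -
      obtain i where i: "i \<in> J" "v = unit_vec n i" using v by auto
      then have "i < n" using J by auto
      with index[OF this, of a] 0 i show ?thesis by simp
    qed
    then show "\<not> lin_dep ?B"
      by (intro Ker.finite_lin_indpt2[OF fin sub]) (auto simp: class_field_def)
    show "?B \<subseteq> mat_kernel A" by (rule sub)
  qed
  with fin have "dim = card ?B" by (rule Ker.dim_basis)
  then show ?thesis using card_image[OF inj] by simp
qed

lemma card_div_mod:
  fixes Z :: "nat set"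
  assumes "Z \<subseteq> {..<n}"
  shows "card {i. i < n * n \<and> i div n \<in> Z \<and> i mod n \<in> Z} = (card Z)\<^sup>2"
proof -
  have "bij_betw (\<lambda>(a, b). a * n + b) (Z \<times> Z) {i. i < n * n \<and> i div n \<in> Z \<and> i mod n \<in> Z}"
  proof (rule bij_betw_byWitness[of _ "\<lambda>i. (i div n, i mod n)"])
    have *: "a * n + b < n * n" if "a < n" "b < n" for a b :: nat
    proof -
      have "a * n + b < Suc a * n" using that by simp
      also have "\<dots> \<le> n * n" using that by (intro mult_le_mono1) simp
      finally show ?thesis .
    qed
    show "(\<lambda>(a, b). a * n + b) ` (Z \<times> Z) \<subseteq> {i. i < n * n \<and> i div n \<in> Z \<and> i mod n \<in> Z}"
      using assms by (auto intro!: *)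
  qed (use assms in auto)
  then have "card (Z \<times> Z) = card {i. i < n * n \<and> i div n \<in> Z \<and> i mod n \<in> Z}"
    by (rule bij_betw_same_card)
  then show ?thesis by (simp add: card_cartesian_product power2_eq_square)
qed

section \<open>The kernel of the defect\<close>

lemma kernel_dim_eq:
  assumes "mat_kernel A = mat_kernel B" "dim_col A = dim_col B"
  shows "kernel_dim A = kernel_dim B"
  using assms by (simp add: kernel_dim_def)

text \<open>A vector killed by \<open>C * C\<^sup>T\<close> is killed by \<open>C\<^sup>T\<close>,
  hence by \<open>D * C\<^sup>T\<close>, which is minus the identity.\<close>

lemma invertible_gram:
  fixes C :: "real mat"
  assumes C: "C \<in> carrier_mat n k" and D: "D \<in> carrier_mat n k" and DC: "D * C\<^sup>T = - 1\<^sub>m n"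
  shows "invertible_mat (C * C\<^sup>T)"
proof -
  have M: "C * C\<^sup>T \<in> carrier_mat n n" using C by simp
  have "det (C * C\<^sup>T) \<noteq> 0"
  proof
    assume "det (C * C\<^sup>T) = 0"
    then obtain v where v: "v \<in> carrier_vec n" "v \<noteq> 0\<^sub>v n" "C * C\<^sup>T *\<^sub>v v = 0\<^sub>v n"
      using det_0_iff_vec_prod_zero_field[OF M] by auto
    have "C\<^sup>T *\<^sub>v v = 0\<^sub>v k" by (rule gram_mult_vec_eq_0[OF C v(1,3)])
    then have "D * C\<^sup>T *\<^sub>v v = 0\<^sub>v n"
      using C D v(1) by (subst assoc_mult_mat_vec[of _ n k _ n]) auto
    then have "- v = 0\<^sub>v n" using v(1) unfolding DC by (simp add: uminus_mult_mat_vec)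
    then show False using v(1,2) by (metis uminus_uminus_vec uminus_zero_vec)
  qed
  from det_non_zero_imp_unit[OF M this, of "()"]
  obtain B where "B \<in> carrier_mat n n" "B * (C * C\<^sup>T) = 1\<^sub>m n" "(C * C\<^sup>T) * B = 1\<^sub>m n"
    by (auto simp: Units_def ring_mat_def)
  then show ?thesis using M by (auto simp: invertible_mat_def inverts_mat_def intro!: exI[of _ B])
qed

text \<open>Writing \<open>M = C C\<^sup>T\<close>, the left-hand side is the Gram matrix of \<open>D (1 - C\<^sup>T Mi C)\<close>, the rows of
  \<open>D\<close> projected onto the orthogonal complement of the row space of \<open>C\<close>.\<close>

lemma gram_minus_inverse_gram:
  fixes C D Mi :: "real mat"
  assumes C: "C \<in> carrier_mat n k" and D: "D \<in> carrier_mat n k" and DC: "D * C\<^sup>T = - 1\<^sub>m n"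
    and Mi: "Mi \<in> carrier_mat n n" and MMi: "C * C\<^sup>T * Mi = 1\<^sub>m n"
  shows "(D + Mi * C) * (D + Mi * C)\<^sup>T = D * D\<^sup>T - Mi"
proof -
  \<comment> \<open>By \<open>DC\<close>, the projected rows
    \<open>D - D * C\<^sup>T * Mi * C\<close> are \<open>D + Mi * C\<close>, whence the plus
    sign.\<close>
  have M: "C * C\<^sup>T \<in> carrier_mat n n" using C by simp
  have CD: "C * D\<^sup>T = - 1\<^sub>m n"
    using arg_cong[OF DC, of transpose_mat] C D by (simp add: transpose_mult[of _ n k] transpose_uminus)
  have MiM: "Mi * (C * C\<^sup>T) = 1\<^sub>m n"
    by (rule mat_mult_left_right_inverse[OF M Mi MMi])
  \<comment> \<open>Transposing \<open>MMi\<close> makes \<open>Mi\<^sup>T\<close> a left inverse of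
    the symmetric \<open>C * C\<^sup>T\<close>, so it agrees with \<open>Mi\<close>.\<close>
  have sym: "Mi\<^sup>T = Mi"
  proof -
    have "Mi\<^sup>T * (C * C\<^sup>T) = 1\<^sub>m n"
      using arg_cong[OF MMi, of transpose_mat] transpose_mult[OF M Mi] transpose_mult[OF C, of "C\<^sup>T" n] C
      by simp
    then have "Mi\<^sup>T * (C * C\<^sup>T) * Mi = Mi" using Mi by simp
    then show ?thesis using Mi MMi M assoc_mult_mat[of "Mi\<^sup>T" n n "C * C\<^sup>T" n Mi n] by simp
  qed
  have MiC: "Mi * C \<in> carrier_mat n k" and MiC': "C\<^sup>T * Mi \<in> carrier_mat k n" using C Mi by auto
  have T: "(D + Mi * C)\<^sup>T = D\<^sup>T + C\<^sup>T * Mi"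
    using transpose_add[OF D MiC] transpose_mult[OF Mi C] sym by simp
  have 1: "D * (C\<^sup>T * Mi) = - Mi"
    using C D Mi by (simp add: assoc_mult_mat[of D n k "C\<^sup>T" n Mi n, symmetric] DC)
  have 2: "Mi * C * D\<^sup>T = - Mi"
    using C D Mi by (simp add: assoc_mult_mat[of Mi n n C k "D\<^sup>T" n] CD)
  have 3: "Mi * C * (C\<^sup>T * Mi) = Mi"
  proof -
    have "Mi * C * (C\<^sup>T * Mi) = Mi * (C * C\<^sup>T * Mi)"
      using C Mi by (simp add: assoc_mult_mat[of Mi n n C k "C\<^sup>T * Mi" n] assoc_mult_mat[of C n k "C\<^sup>T" n Mi n])
    then show ?thesis using Mi by (simp add: MMi)
  qed
  \<comment> \<open>The last three terms are \<open>- Mi\<close>, \<open>- Mi\<close> and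
    \<open>Mi\<close>.\<close>
  have "(D + Mi * C) * (D + Mi * C)\<^sup>T = D * D\<^sup>T + Mi * C * D\<^sup>T + (D * (C\<^sup>T * Mi) + Mi * C * (C\<^sup>T * Mi))"
    unfolding T using C D Mi MiC MiC'
    by (simp add: add_mult_distrib_mat[of D n k "Mi * C" _ n] mult_add_distrib_mat[of _ n k "D\<^sup>T" n "C\<^sup>T * Mi"])
  also have "\<dots> = D * D\<^sup>T - Mi"
    unfolding 1 2 3 using D Mi by (intro eq_matI) auto
  finally show ?thesis .
qed

text \<open>The linear algebra core, with \<open>R\<close> inverse to \<open>S\<close>. The
  substitution by \<open>kron R R\<close> turns the kernel into the vectors supported on index pairs
  with \<open>d\<close> zero at both components, whence the square.\<close>

lemma kernel_dim_kron_defect: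
  fixes C D Mi R :: "real mat"
  assumes C: "C \<in> carrier_mat n k" and D: "D \<in> carrier_mat n k" and DC: "D * C\<^sup>T = - 1\<^sub>m n"
    and M_def: "M = C * C\<^sup>T" and S_def: "S = D * D\<^sup>T" and X_def: "X = S - Mi"
    and Mi: "Mi \<in> carrier_mat n n" and MMi: "M * Mi = 1\<^sub>m n"
    and R: "R \<in> carrier_mat n n" and SR: "S * R = 1\<^sub>m n"
    and MR: "M = R + mat_diag n d"
  shows "kernel_dim (kron M X + kron X M) = (card {i. i < n \<and> d i = 0})\<^sup>2"
proof -
  define Y where "Y = D + Mi * C"
  define E where "E = mat_diag n d"
  define P where "P = kron R R"
  define \<Delta> where "\<Delta> = kron M X + kron X M"
  have M: "M \<in> carrier_mat n n" and S: "S \<in> carrier_mat n n" and Y: "Y \<in> carrier_mat n k"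
    and E: "E \<in> carrier_mat n n"
    using C D Mi by (auto simp: M_def S_def Y_def E_def)
  have X: "X \<in> carrier_mat n n" unfolding X_def by (rule minus_carrier_mat[OF Mi])
  note car = M S Mi R E X
  note kr = kron_carrier[of _ n n _ n n]
  \<comment> \<open>Both summands of \<open>\<Delta>\<close> are positive semidefinite, so \<open>\<Delta> v = 0\<close> forces both to annihilate \<open>v\<close>;
    by \<open>X R = Mi E\<close> the substitution \<open>v = P w\<close> turns these two conditions into diagonal ones.\<close>
  have YY: "X = Y * Y\<^sup>T"
    unfolding X_def S_def Y_def
    using gram_minus_inverse_gram[OF C D DC Mi] MMi M_def by simp
  have MiM: "Mi * M = 1\<^sub>m n" by (rule mat_mult_left_right_inverse[OF M Mi MMi])
  have RS: "R * S = 1\<^sub>m n" by (rule mat_mult_left_right_inverse[OF S R SR])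
  \<comment> \<open>Both \<open>S * R\<close> and \<open>Mi * M = Mi * R + Mi * E\<close> are the
    identity.\<close>
  have XR: "X * R = Mi * E"
  proof -
    have "Mi * R + Mi * E = 1\<^sub>m n"
      using MiM mult_add_distrib_mat[OF Mi R E] MR by (simp add: E_def)
    then have "1\<^sub>m n - Mi * R = (Mi * R + Mi * E) - Mi * R" by simp
    also have "\<dots> = Mi * E" using car by (intro eq_matI) auto
    finally show ?thesis
      using car SR by (simp add: X_def minus_mult_distrib_mat[OF S Mi R])
  qed
  have P: "P \<in> carrier_mat (n * n) (n * n)" using R kr by (simp add: P_def)
  have Pinv: "P * kron S S = 1\<^sub>m (n * n)"
  proof -
    have "P * kron S S = kron (R * S) (R * S)" unfolding P_def by (rule kron_mult[OF R R S S])
    also have "\<dots> = kron (1\<^sub>m n) (mat_diag n (\<lambda>_. 1))" unfolding RS by simp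
    also have "\<dots> = 1\<^sub>m (n * n)" unfolding kron_one_mat_diag by simp
    finally show ?thesis .
  qed
  have \<Delta>: "\<Delta> \<in> carrier_mat (n * n) (n * n)" using kr[OF M X] kr[OF X M] by (simp add: \<Delta>_def)
  have KMX: "kron M X = kron C Y * (kron C Y)\<^sup>T" and KXM: "kron X M = kron Y C * (kron Y C)\<^sup>T"
    using C Y by (simp_all add: YY M_def kron_transpose kron_mult[of _ n k _ n k _ n _ n])
  have zero_iff: "\<Delta> *\<^sub>v v = 0\<^sub>v (n * n) \<longleftrightarrow>
      kron M X *\<^sub>v v = 0\<^sub>v (n * n) \<and> kron X M *\<^sub>v v = 0\<^sub>v (n * n)"
    if v: "v \<in> carrier_vec (n * n)" for v
  proof
    assume "\<Delta> *\<^sub>v v = 0\<^sub>v (n * n)"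
    then show "kron M X *\<^sub>v v = 0\<^sub>v (n * n) \<and> kron X M *\<^sub>v v = 0\<^sub>v (n * n)"
      unfolding \<Delta>_def KMX KXM
      using gram_add_mult_vec_eq_0[OF kron_carrier[OF C Y] kron_carrier[OF Y C] v] by blast
  next
    assume "kron M X *\<^sub>v v = 0\<^sub>v (n * n) \<and> kron X M *\<^sub>v v = 0\<^sub>v (n * n)"
    then show "\<Delta> *\<^sub>v v = 0\<^sub>v (n * n)"
      unfolding \<Delta>_def using add_mult_distrib_mat_vec[OF kr[OF M X] kr[OF X M] v] by simp
  qed
  have MXR: "M * (Mi * E) = E"
    using car by (simp add: assoc_mult_mat[of M n n Mi n E n, symmetric] MMi)
  have SMi: "S * Mi \<in> carrier_mat n n" and MR': "M * R \<in> carrier_mat n n" and MiE: "Mi * E \<in> carrier_mat n n"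
    using car by auto
  have SMMR: "S * Mi * (M * R) = 1\<^sub>m n"
  proof -
    have "S * Mi * (M * R) = S * (Mi * M) * R"
      using car by (simp add: assoc_mult_mat[of _ n n _ n _ n])
    then show ?thesis using car by (simp add: MiM SR)
  qed
  \<comment> \<open>\<open>left\<close> and \<open>right\<close> make \<open>kron M X * P\<close>
    and \<open>kron (1\<^sub>m n) E\<close> left multiples of each other, and likewise the mirrored
    pair, so their kernels agree.\<close>
  have left: "kron M X * P = kron (M * R) Mi * kron (1\<^sub>m n) E"
    "kron X M * P = kron Mi (M * R) * kron E (1\<^sub>m n)"
    using car MR' by (simp_all add: P_def kron_mult[of _ n n _ n n _ n _ n] XR)
  have right: "kron (S * Mi) M * (kron M X * P) = kron (1\<^sub>m n) E"
    "kron M (S * Mi) * (kron X M * P) = kron E (1\<^sub>m n)"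
    using car MR' SMi MiE by (simp_all add: P_def kron_mult[of _ n n _ n n _ n _ n] XR MXR SMMR)
  have mult_zero: "A *\<^sub>v (B *\<^sub>v w) = 0\<^sub>v (n * n)"
    if "A \<in> carrier_mat (n * n) (n * n)" "B *\<^sub>v w = 0\<^sub>v (n * n)" for A B :: "real mat" and w
    using that by auto
  have kernel: "\<Delta> * P *\<^sub>v w = 0\<^sub>v (n * n) \<longleftrightarrow>
      (\<forall>i<n * n. i \<notin> {i. i < n * n \<and> i div n \<in> {i. i < n \<and> d i = 0} \<and> i mod n \<in> {i. i < n \<and> d i = 0}} \<longrightarrow> w $ i = 0)"
    if w: "w \<in> carrier_vec (n * n)" for w
  proof -
    have I1: "kron (1\<^sub>m n) E \<in> carrier_mat (n * n) (n * n)" and I2: "kron E (1\<^sub>m n) \<in> carrier_mat (n * n) (n * n)"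
      using E kr by auto
    have L1: "kron (M * R) Mi \<in> carrier_mat (n * n) (n * n)" "kron Mi (M * R) \<in> carrier_mat (n * n) (n * n)"
      "kron (S * Mi) M \<in> carrier_mat (n * n) (n * n)" "kron M (S * Mi) \<in> carrier_mat (n * n) (n * n)"
      using kr SMi MR' M Mi by auto
    have Pw: "P *\<^sub>v w \<in> carrier_vec (n * n)" using P w by simp
    have "\<Delta> * P *\<^sub>v w = 0\<^sub>v (n * n) \<longleftrightarrow>
        kron M X * P *\<^sub>v w = 0\<^sub>v (n * n) \<and> kron X M * P *\<^sub>v w = 0\<^sub>v (n * n)"
      using zero_iff[OF Pw] assoc_mult_mat_vec[OF \<Delta> P w] assoc_mult_mat_vec[OF kr[OF M X] P w]
        assoc_mult_mat_vec[OF kr[OF X M] P w] by simp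
    also have "kron M X * P *\<^sub>v w = 0\<^sub>v (n * n) \<longleftrightarrow> kron (1\<^sub>m n) E *\<^sub>v w = 0\<^sub>v (n * n)"
    proof
      assume "kron M X * P *\<^sub>v w = 0\<^sub>v (n * n)"
      from mult_zero[OF L1(3) this] show "kron (1\<^sub>m n) E *\<^sub>v w = 0\<^sub>v (n * n)"
        using assoc_mult_mat_vec[OF L1(3) mult_carrier_mat[OF kr[OF M X] P] w] right(1) by simp
    next
      assume "kron (1\<^sub>m n) E *\<^sub>v w = 0\<^sub>v (n * n)"
      from mult_zero[OF L1(1) this] show "kron M X * P *\<^sub>v w = 0\<^sub>v (n * n)"
        using assoc_mult_mat_vec[OF L1(1) I1 w] left(1) by simp
    qed
    also have "kron X M * P *\<^sub>v w = 0\<^sub>v (n * n) \<longleftrightarrow> kron E (1\<^sub>m n) *\<^sub>v w = 0\<^sub>v (n * n)"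
    proof
      assume "kron X M * P *\<^sub>v w = 0\<^sub>v (n * n)"
      from mult_zero[OF L1(4) this] show "kron E (1\<^sub>m n) *\<^sub>v w = 0\<^sub>v (n * n)"
        using assoc_mult_mat_vec[OF L1(4) mult_carrier_mat[OF kr[OF X M] P] w] right(2) by simp
    next
      assume "kron E (1\<^sub>m n) *\<^sub>v w = 0\<^sub>v (n * n)"
      from mult_zero[OF L1(2) this] show "kron X M * P *\<^sub>v w = 0\<^sub>v (n * n)"
        using assoc_mult_mat_vec[OF L1(2) I2 w] left(2) by simp
    qed
    also have "kron (1\<^sub>m n) E *\<^sub>v w = 0\<^sub>v (n * n) \<longleftrightarrow> (\<forall>i<n * n. d (i mod n) = 0 \<or> w $ i = 0)"
      unfolding E_def kron_one_mat_diag by (rule mat_diag_mult_vec_eq_0[OF w])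
    also have "kron E (1\<^sub>m n) *\<^sub>v w = 0\<^sub>v (n * n) \<longleftrightarrow> (\<forall>i<n * n. d (i div n) = 0 \<or> w $ i = 0)"
      unfolding E_def kron_mat_diag_one by (rule mat_diag_mult_vec_eq_0[OF w])
    finally show ?thesis
      using div_less_of_less_mult[of _ n n] mod_less_of_less_mult[of _ n n] by auto
  qed
  have "kernel_dim \<Delta> = kernel_dim (\<Delta> * P)"
    using mat_kernel_dim_mult_eq_right[OF \<Delta> P kr[OF S S] Pinv] \<Delta> P by (simp add: kernel_dim_def)
  also have "\<dots> = card {i. i < n * n \<and> i div n \<in> {i. i < n \<and> d i = 0} \<and> i mod n \<in> {i. i < n \<and> d i = 0}}"
    by (rule kernel_dim_coordinate_subspace[OF mult_carrier_mat[OF \<Delta> P] _ kernel]) auto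
  also have "\<dots> = (card {i. i < n \<and> d i = 0})\<^sup>2"
    by (rule card_div_mod) auto
  finally show ?thesis unfolding \<Delta>_def .
qed

section \<open>The Galerkin matrices\<close>

text \<open>The column count is free: \<open>n + 2\<close> columns hold all coefficients of the
  \<open>n\<close> rows, while the truncation to \<open>n\<close> columns yields the inverse of
  \<open>Smat\<close>.\<close>

definition psi_mat :: "nat \<Rightarrow> nat \<Rightarrow> real mat" where
  "psi_mat n k = mat n k (\<lambda>(i, j). psi_coeff (i + 1) j)"

definition dphi_mat :: "nat \<Rightarrow> nat \<Rightarrow> real mat" where
  "dphi_mat n k = mat n k (\<lambda>(i, j). dphi_coeff (i + 1) j)"

lemma mult_transpose_mat:
  "mat n k f * (mat m k g)\<^sup>T = mat n m (\<lambda>(i, j). \<Sum>l<k. f (i, l) * g (j, l))"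
  by (rule eq_matI) (auto simp: scalar_prod_def lessThan_atLeast0 intro!: sum.cong)

lemma Mmat_eq_gram: "Mmat (n + 1) = psi_mat n (n + 2) * (psi_mat n (n + 2))\<^sup>T"
  unfolding psi_mat_def mult_transpose_mat Mmat_def
proof (rule cong_mat)
  fix i j assume "i < n + 1 - 1" "j < n + 1 - 1"
  then have i: "i < n" and j: "j < n" by simp_all
  have "psi (i + 1) = (\<Sum>k<n + 2. Polynomial.smult (psi_coeff (i + 1) k) (phi k))"
    by (rule psi_eq_sum_phi) (use i in simp_all)
  moreover have "psi (j + 1) = (\<Sum>k<n + 2. Polynomial.smult (psi_coeff (j + 1) k) (phi k))"
    by (rule psi_eq_sum_phi) (use j in simp_all)
  ultimately show "(case (i, j) of (i, j) \<Rightarrow> l2ip (psi (j + 1)) (psi (i + 1))) =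
      (case (i, j) of (i, j) \<Rightarrow> \<Sum>l<n + 2. (case (i, l) of (i, j) \<Rightarrow> psi_coeff (i + 1) j) *
         (case (j, l) of (i, j) \<Rightarrow> psi_coeff (i + 1) j))"
    by (simp only: l2ip_sum_phi prod.case mult.commute)
qed simp_all

text \<open>The derivatives have degree below \<open>n\<close>, so \<open>k\<close> may be
  \<open>n + 2\<close>, to match the full \<open>psi_mat\<close>, or \<open>n\<close>, to make the
  matrix square.\<close>

lemma Smat_eq_gram:
  assumes "n \<le> k"
  shows "Smat (n + 1) = dphi_mat n k * (dphi_mat n k)\<^sup>T"
  unfolding dphi_mat_def mult_transpose_mat Smat_def
proof (rule cong_mat)
  fix i j assume "i < n + 1 - 1" "j < n + 1 - 1"
  with assms have "pderiv (phi (i + 1)) = (\<Sum>l<k. Polynomial.smult (dphi_coeff (i + 1) l) (phi l))"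
    "pderiv (phi (j + 1)) = (\<Sum>l<k. Polynomial.smult (dphi_coeff (j + 1) l) (phi l))"
    by (auto intro!: pderiv_phi_eq_sum_phi)
  then show "(case (i, j) of (i, j) \<Rightarrow> l2ip (pderiv (phi (j + 1))) (pderiv (phi (i + 1)))) =
      (case (i, j) of (i, j) \<Rightarrow> \<Sum>l<k. (case (i, l) of (i, j) \<Rightarrow> dphi_coeff (i + 1) j) *
         (case (j, l) of (i, j) \<Rightarrow> dphi_coeff (i + 1) j))"
    by (simp only: l2ip_sum_phi prod.case mult.commute)
qed simp_all

text \<open>The entries of \<open>dphi_mat\<close> vanish from column \<open>n\<close> on, so the
  sum can be cut to \<open>n\<close> terms and extended to \<open>n + 2\<close>, where
  \<open>sum_psi_coeff_mult_dphi_coeff\<close> applies.\<close>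

lemma dphi_mat_mult_psi_mat:
  assumes "n \<le> k"
  shows "dphi_mat n k * (psi_mat n k)\<^sup>T = - 1\<^sub>m n"
  unfolding dphi_mat_def psi_mat_def mult_transpose_mat
proof (rule eq_matI)
  fix i j assume "i < dim_row (- 1\<^sub>m n :: real mat)" "j < dim_col (- 1\<^sub>m n :: real mat)"
  then have i: "i < n" and j: "j < n" by simp_all
  have "(\<Sum>l<k. dphi_coeff (i + 1) l * psi_coeff (j + 1) l) = (\<Sum>l<n. dphi_coeff (i + 1) l * psi_coeff (j + 1) l)"
    using assms i by (intro sum.mono_neutral_right) (auto simp: dphi_coeff_def)
  also have "\<dots> = (\<Sum>l<n + 2. psi_coeff (j + 1) l * dphi_coeff (i + 1) l)"
    using i by (intro sum.mono_neutral_cong_left) (auto simp: dphi_coeff_def)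
  also have "\<dots> = (if j = i then - 1 else 0)"
    using j by (subst sum_psi_coeff_mult_dphi_coeff) auto
  finally show "mat n n (\<lambda>(i, j). \<Sum>l<k. (case (i, l) of (i, j) \<Rightarrow> dphi_coeff (i + 1) j) *
      (case (j, l) of (i, j) \<Rightarrow> psi_coeff (i + 1) j)) $$ (i, j) = (- 1\<^sub>m n) $$ (i, j)"
    using i j by auto
qed simp_all

text \<open>With \<open>n\<close> columns the coefficient matrices are square, so
  \<open>?D * ?C\<^sup>T\<close> may be commuted; its transpose then collapses the middle of the
  product.\<close>

lemma Smat_mult_psi_gram:
  "Smat (n + 1) * (psi_mat n n * (psi_mat n n)\<^sup>T) = 1\<^sub>m n"
proof -
  let ?C = "psi_mat n n" and ?D = "dphi_mat n n"
  have C: "?C \<in> carrier_mat n n" and D: "?D \<in> carrier_mat n n" by (simp_all add: psi_mat_def dphi_mat_def)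
  have DC: "?D * ?C\<^sup>T = - 1\<^sub>m n" by (rule dphi_mat_mult_psi_mat) simp
  have "- ?D * ?C\<^sup>T = 1\<^sub>m n"
    using C D by (simp add: DC)
  then have "?C\<^sup>T * - ?D = 1\<^sub>m n"
    using C D by (intro mat_mult_left_right_inverse[of "- ?D" n "?C\<^sup>T"]) auto
  then have CD: "?C\<^sup>T * ?D = - 1\<^sub>m n"
    using C D by (metis carrier_matD uminus_mult_right_mat uminus_uminus_mat index_transpose_mat(3))
  have DC': "?D\<^sup>T * ?C = - 1\<^sub>m n"
    using arg_cong[OF CD, of transpose_mat] C D by (simp add: transpose_mult[of _ n n] transpose_uminus)
  have "?D * ?D\<^sup>T * (?C * ?C\<^sup>T) = ?D * (?D\<^sup>T * ?C) * ?C\<^sup>T"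
    using C D by (simp add: assoc_mult_mat[of _ n n _ n _ n])
  also have "\<dots> = 1\<^sub>m n" using C D by (simp add: DC' DC)
  finally show ?thesis unfolding Smat_eq_gram[OF order_refl] .
qed

text \<open>Each of the two columns lost by truncation has at most one nonzero entry, so its outer
  product with itself is diagonal.\<close>

lemma Mmat_eq_add_diag:
  "Mmat (n + 1) = psi_mat n n * (psi_mat n n)\<^sup>T +
     mat_diag n (\<lambda>i. (psi_coeff (i + 1) n)\<^sup>2 + (psi_coeff (i + 1) (n + 1))\<^sup>2)"
  unfolding Mmat_eq_gram psi_mat_def mult_transpose_mat mat_diag_def
  by (rule eq_matI) (auto simp: psi_coeff_def power2_eq_square)

lemma kernel_dim_Mmat_Smat_defect:
  assumes "n \<ge> 2"
  shows "kernel_dim (kron (Mmat (n + 1)) (Smat (n + 1) - matinv (Mmat (n + 1))) +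
      kron (Smat (n + 1) - matinv (Mmat (n + 1))) (Mmat (n + 1))) = (n - 2)\<^sup>2"
proof -
  let ?C = "psi_mat n (n + 2)" and ?D = "dphi_mat n (n + 2)" and ?R = "psi_mat n n * (psi_mat n n)\<^sup>T"
  let ?d = "\<lambda>i. (psi_coeff (i + 1) n)\<^sup>2 + (psi_coeff (i + 1) (n + 1))\<^sup>2"
  have C: "?C \<in> carrier_mat n (n + 2)" and D: "?D \<in> carrier_mat n (n + 2)"
    by (simp_all add: psi_mat_def dphi_mat_def)
  have R: "?R \<in> carrier_mat n n" by (intro mult_carrier_mat[of _ n n]) (simp_all add: psi_mat_def)
  have M: "Mmat (n + 1) \<in> carrier_mat n n" by (simp add: Mmat_def)
  have DC: "?D * ?C\<^sup>T = - 1\<^sub>m n" by (rule dphi_mat_mult_psi_mat) simp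
  have inv: "invertible_mat (Mmat (n + 1))"
    unfolding Mmat_eq_gram by (rule invertible_gram[OF C D DC])
  have S: "Smat (n + 1) = ?D * ?D\<^sup>T" by (rule Smat_eq_gram) simp
  \<comment> \<open>Column \<open>n\<close> meets only row \<open>n - 2\<close>, and column
    \<open>n + 1\<close> only row \<open>n - 1\<close>; \<open>n \<ge> 2\<close> makes these the
    last two rows.\<close>
  have "psi_coeff (i + 1) n = 0 \<longleftrightarrow> n \<noteq> i + 2" "psi_coeff (i + 1) (n + 1) = 0 \<longleftrightarrow> n \<noteq> i + 1" if "i < n" for i
    using that by (auto simp: psi_coeff_def)
  then have "?d i = 0 \<longleftrightarrow> n \<noteq> i + 2 \<and> n \<noteq> i + 1" if "i < n" for i
    using that by (simp add: sum_power2_eq_zero_iff)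
  then have "?d i = 0 \<longleftrightarrow> i < n - 2" if "i < n" for i
    using that assms by (simp only:) arith
  then have "{i. i < n \<and> ?d i = 0} = {..<n - 2}"
    by (auto simp only: mem_Collect_eq lessThan_iff)
  then show ?thesis
    using kernel_dim_kron_defect[OF C D DC Mmat_eq_gram S refl matinv_inverse(3)[OF M inv]
        matinv_inverse(1)[OF M inv] R Smat_mult_psi_gram Mmat_eq_add_diag] by simp
qed

theorem mainTheorem8:
  fixes N :: nat and \<kappa> :: real
  assumes "N \<ge> 4"
    and "invertible_mat (Atilde N \<kappa>)"
  shows "kernel_dim (matinv (Atilde N \<kappa>) * Amat N \<kappa> - 1\<^sub>m ((N - 1)^2)) = (N - 3)^2"
proof -
  define n where "n = N - 1"
  have N: "N = n + 1" and n: "n \<ge> 2" using assms(1) by (auto simp: n_def)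
  define M S Mi where "M = Mmat N" and "S = Smat N" and "Mi = matinv M"
  let ?\<Delta> = "kron M (S - Mi) + kron (S - Mi) M"
  have M: "M \<in> carrier_mat n n" and S: "S \<in> carrier_mat n n"
    by (simp_all add: M_def S_def Mmat_def Smat_def N)
  have "invertible_mat M"
    unfolding M_def N Mmat_eq_gram
    by (rule invertible_gram[of _ n "n + 2" "dphi_mat n (n + 2)"])
       (simp_all add: psi_mat_def dphi_mat_def flip: dphi_mat_mult_psi_mat[of n "n + 2"])
  then have Mi: "Mi \<in> carrier_mat n n" unfolding Mi_def by (rule matinv_inverse(3)[OF M])
  note kr = kron_carrier[of _ n n _ n n]
  have I: "1\<^sub>m n \<in> carrier_mat n n" by simp
  note car = kr[OF M S] kr[OF S M] kr[OF M Mi] kr[OF Mi M] kr[OF I I] kr[OF I M] kr[OF M I]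
  have A: "Amat N \<kappa> \<in> carrier_mat (n * n) (n * n)" and At: "Atilde N \<kappa> \<in> carrier_mat (n * n) (n * n)"
    unfolding Amat_def Atilde_def Let_def n_def[symmetric] M_def[symmetric] S_def[symmetric] Mi_def[symmetric]
    using car by auto
  \<comment> \<open>The identity and \<open>\<kappa>\<close> terms are common to both matrices and
    cancel.\<close>
  have diff: "Amat N \<kappa> - Atilde N \<kappa> = ?\<Delta>"
    unfolding Amat_def Atilde_def Let_def n_def[symmetric] M_def[symmetric] S_def[symmetric] Mi_def[symmetric]
      kron_diff_left[OF S Mi M] kron_diff_right[OF M S Mi]
    using car by (intro eq_matI) auto
  let ?Ai = "matinv (Atilde N \<kappa>)"
  note Ai = matinv_inverse[OF At assms(2)]
  have \<Delta>: "?\<Delta> \<in> carrier_mat (n * n) (n * n)" unfolding diff[symmetric] by (rule minus_carrier_mat[OF At])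
  have "?Ai * Amat N \<kappa> - 1\<^sub>m ((N - 1)^2) = ?Ai * ?\<Delta>"
    unfolding diff[symmetric] mult_minus_distrib_mat[OF Ai(3) A At] Ai(2)
    by (simp add: n_def power2_eq_square)
  \<comment> \<open>Left multiplication by the invertible \<open>?Ai\<close> leaves the kernel
    unchanged.\<close>
  moreover have "kernel_dim (?Ai * ?\<Delta>) = kernel_dim ?\<Delta>"
    by (rule kernel_dim_eq[OF mat_kernel_mult_eq[OF \<Delta> Ai(3) At Ai(1)]]) simp
  ultimately show ?thesis
    using kernel_dim_Mmat_Smat_defect[OF n] by (simp add: M_def S_def Mi_def N)
qed

end
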